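(* If the prime-depleted Szpiro conjecture is true over $\mathbb{Q}$, then the prime-depleted $ABC$-conjecture is true. That is: suppose there exist an integer $J\ge 0$ and a constant $C_3$ such that $$\sigma_J\bigl(\mathfrak{D}(E/\mathbb{Q})\bigr)\le C_3$$ for all elliptic curves $E/\mathbb{Q}$. Then there exist an integer $J'\ge 0$ and a constant $C_5$ such that for all nonzero integers $A,B,C\in\mathbb{Z}$ satisfying $A+B+C=0$ and $\gcd(A,B,C)=1$, $$\sigma_{J'}(ABC)\le C_5 .$$
   Context: Here $\mathfrak{D}(E/\mathbb{Q})$ denotes the minimal discriminant of $E/\mathbb{Q}$, regarded as a nonzero integer up to sign (equivalently, an ideal of $\mathbb{Z}$). Szpiro ratio: for a nonzero integer $D$ with $|D|=\prod_{i=1}^{\nu(D)}p_i^{e_i}$, the $p_i$ distinct primes and $e_i\ge1$, where $\nu(D)$ is the number of distinct primes dividing $D$, set $$\sigma(D)=\frac{\sum_i e_i\log p_i}{\sum_i\log p_i},\qquad \sigma(\pm1)=1.$$ $J$-depleted Szpiro ratio: for an integer $J\ge 0$, $$\sigma_J(D)=\min_{\substack{I\subset\{1,\dots,\nu(D)\}\\ \#I\ge \nu(D)-J}}\ \sigma\Bigl(\prod_{i\in I}p_i^{e_i}\Bigr).$$ In particular $\sigma_J(D)=1$ if $\nu(D)\le J$. *)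

theory Defs
  imports Complex_Main "HOL-Computational_Algebra.Primes"
begin

section \<open>Szpiro ratios\<close>

definition szpiro_ratio :: "int \<Rightarrow> real" where
  "szpiro_ratio D =
     (if \<bar>D\<bar> = 1 then 1
      else (\<Sum>p\<in>prime_factors D. real (multiplicity p D) * ln (real_of_int p)) /
           (\<Sum>p\<in>prime_factors D. ln (real_of_int p)))"

text \<open>The index set \<open>I\<close> is taken as a set of primes dividing \<open>D\<close>; the condition
  \<open>#I \<ge> \<nu>(D) - J\<close> is written additively to avoid truncated subtraction.\<close>

definition depleted_szpiro_ratio :: "nat \<Rightarrow> int \<Rightarrow> real" where
  "depleted_szpiro_ratio J D =
     Min {szpiro_ratio (\<Prod>p\<in>I. p ^ multiplicity p D) | I.
            I \<subseteq> prime_factors D \<and> card I + J \<ge> card (prime_factors D)}"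


section \<open>Weierstrass equations over the rationals\<close>

text \<open>The equation \<open>y\<^sup>2 + a1 x y + a3 y = x\<^sup>3 + a2 x\<^sup>2 + a4 x + a6\<close>. An elliptic curve over the
  rationals is represented by such an equation with nonzero discriminant.\<close>

record weierstrass =
  a1 :: rat
  a2 :: rat
  a3 :: rat
  a4 :: rat
  a6 :: rat

definition b2 :: "weierstrass \<Rightarrow> rat" where
  "b2 E = (a1 E)\<^sup>2 + 4 * a2 E"

definition b4 :: "weierstrass \<Rightarrow> rat" where
  "b4 E = 2 * a4 E + a1 E * a3 E"

definition b6 :: "weierstrass \<Rightarrow> rat" where
  "b6 E = (a3 E)\<^sup>2 + 4 * a6 E"

definition b8 :: "weierstrass \<Rightarrow> rat" where
  "b8 E = (a1 E)\<^sup>2 * a6 E + 4 * a2 E * a6 E - a1 E * a3 E * a4 E + a2 E * (a3 E)\<^sup>2 - (a4 E)\<^sup>2"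

definition discriminant :: "weierstrass \<Rightarrow> rat" where
  "discriminant E = - (b2 E)\<^sup>2 * b8 E - 8 * (b4 E) ^ 3 - 27 * (b6 E)\<^sup>2 + 9 * b2 E * b4 E * b6 E"

definition elliptic_curve :: "weierstrass \<Rightarrow> bool" where
  "elliptic_curve E \<longleftrightarrow> discriminant E \<noteq> 0"

text \<open>The equation obtained by the substitution \<open>x = u\<^sup>2 x' + r\<close>, \<open>y = u\<^sup>3 y' + s u\<^sup>2 x' + t\<close>,
  divided by \<open>u\<^sup>6\<close>; see \<open>weierstrass_eval_change_vars\<close> below.\<close>

definition change_vars :: "rat \<Rightarrow> rat \<Rightarrow> rat \<Rightarrow> rat \<Rightarrow> weierstrass \<Rightarrow> weierstrass" where
  "change_vars u r s t E =
     \<lparr> a1 = (a1 E + 2 * s) / u,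
       a2 = (a2 E - s * a1 E + 3 * r - s\<^sup>2) / u\<^sup>2,
       a3 = (a3 E + r * a1 E + 2 * t) / u ^ 3,
       a4 = (a4 E - s * a3 E + 2 * r * a2 E - (t + r * s) * a1 E + 3 * r\<^sup>2 - 2 * s * t) / u ^ 4,
       a6 = (a6 E + r * a4 E + r\<^sup>2 * a2 E + r ^ 3 - t * a3 E - t\<^sup>2 - r * t * a1 E) / u ^ 6 \<rparr>"

definition weierstrass_eval :: "weierstrass \<Rightarrow> rat \<Rightarrow> rat \<Rightarrow> rat" where
  "weierstrass_eval E x y =
     y\<^sup>2 + a1 E * x * y + a3 E * y - (x ^ 3 + a2 E * x\<^sup>2 + a4 E * x + a6 E)"

lemma weierstrass_eval_change_vars:
  assumes "u \<noteq> 0"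
  shows "u ^ 6 * weierstrass_eval (change_vars u r s t E) x y =
           weierstrass_eval E (u\<^sup>2 * x + r) (u ^ 3 * y + s * u\<^sup>2 * x + t)"
  using assms unfolding weierstrass_eval_def change_vars_def
  by (simp add: field_simps) algebra

lemma discriminant_change_vars:
  assumes "u \<noteq> 0"
  shows "u ^ 12 * discriminant (change_vars u r s t E) = discriminant E"
proof -
  define F where "F = change_vars u r s t E"
  have "u * a1 F = a1 E + 2 * s" "u\<^sup>2 * a2 F = a2 E - s * a1 E + 3 * r - s\<^sup>2"
    "u ^ 3 * a3 F = a3 E + r * a1 E + 2 * t"
    "u ^ 4 * a4 F = a4 E - s * a3 E + 2 * r * a2 E - (t + r * s) * a1 E + 3 * r\<^sup>2 - 2 * s * t"
    "u ^ 6 * a6 F = a6 E + r * a4 E + r\<^sup>2 * a2 E + r ^ 3 - t * a3 E - t\<^sup>2 - r * t * a1 E"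
    using assms by (simp_all add: F_def change_vars_def)
  note a = this
  have b2: "u\<^sup>2 * b2 F = b2 E + 12 * r"
    unfolding b2_def using a(1,2) by algebra
  have b4: "u ^ 4 * b4 F = b4 E + r * b2 E + 6 * r\<^sup>2"
    unfolding b2_def b4_def using a(1,3,4) by algebra
  have b6: "u ^ 6 * b6 F = b6 E + 2 * r * b4 E + r\<^sup>2 * b2 E + 4 * r ^ 3"
    unfolding b2_def b4_def b6_def using a(3,5) by algebra
  have b8': "4 * b8 W = b2 W * b6 W - (b4 W)\<^sup>2" for W
    unfolding b2_def b4_def b6_def b8_def by algebra
  have b8: "u ^ 8 * b8 F = b8 E + 3 * r * b6 E + 3 * r\<^sup>2 * b4 E + r ^ 3 * b2 E + 3 * r ^ 4"
  proof -
    have "4 * (u ^ 8 * b8 F) = (u\<^sup>2 * b2 F) * (u ^ 6 * b6 F) - (u ^ 4 * b4 F)\<^sup>2"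
      using b8'[of F] by algebra
    also have "\<dots> = 4 * (b8 E + 3 * r * b6 E + 3 * r\<^sup>2 * b4 E + r ^ 3 * b2 E + 3 * r ^ 4)"
      unfolding b2 b4 b6 using b8'[of E] by algebra
    finally show ?thesis by simp
  qed
  have "u ^ 12 * discriminant F =
      - (u\<^sup>2 * b2 F)\<^sup>2 * (u ^ 8 * b8 F) - 8 * (u ^ 4 * b4 F) ^ 3 - 27 * (u ^ 6 * b6 F)\<^sup>2
      + 9 * (u\<^sup>2 * b2 F) * (u ^ 4 * b4 F) * (u ^ 6 * b6 F)"
    unfolding discriminant_def by algebra
  also have "\<dots> = discriminant E"
    unfolding b2 b4 b6 b8 discriminant_def using b8'[of E] by algebra
  finally show ?thesis by (simp add: F_def)
qed


section \<open>The minimal discriminant\<close>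

text \<open>Meaningful only for nonzero arguments; \<open>quotient_of\<close> is the reduced fraction.\<close>

definition rat_valuation :: "int \<Rightarrow> rat \<Rightarrow> int" where
  "rat_valuation p q =
     int (multiplicity p (fst (quotient_of q))) - int (multiplicity p (snd (quotient_of q)))"

definition p_integral :: "int \<Rightarrow> rat \<Rightarrow> bool" where
  "p_integral p q \<longleftrightarrow> \<not> p dvd snd (quotient_of q)"

definition p_integral_equation :: "int \<Rightarrow> weierstrass \<Rightarrow> bool" where
  "p_integral_equation p E \<longleftrightarrow>
     p_integral p (a1 E) \<and> p_integral p (a2 E) \<and> p_integral p (a3 E) \<and>
     p_integral p (a4 E) \<and> p_integral p (a6 E)"

text \<open>The valuation of the discriminant of a minimal equation at \<open>p\<close>. For elliptic curves the
  minimum is attained: clearing denominators gives a \<open>p\<close>-integral equation, and the discriminant of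
  such an equation has nonnegative valuation.\<close>

definition minimal_discriminant_exponent :: "int \<Rightarrow> weierstrass \<Rightarrow> nat" where
  "minimal_discriminant_exponent p E =
     (LEAST n. \<exists>u r s t. u \<noteq> 0 \<and> p_integral_equation p (change_vars u r s t E) \<and>
        rat_valuation p (discriminant (change_vars u r s t E)) = int n)"

text \<open>The positive generator of the minimal discriminant ideal. For elliptic curves the product is
  over a finite set, as almost every prime divides neither the discriminant nor the denominators
  of the coefficients of \<open>E\<close>.\<close>

definition minimal_discriminant :: "weierstrass \<Rightarrow> int" where
  "minimal_discriminant E =
     (\<Prod>p | prime p \<and> minimal_discriminant_exponent p E \<noteq> 0.
        p ^ minimal_discriminant_exponent p E)"

end

theory Submission
  imports Defs
begin

text \<open>For coprime \<open>A + B + C = 0\<close>, the Frey curve \<open>y\<^sup>2 = x (x - A) (x + B)\<close> has discriminant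
  \<open>16 (A B C)\<^sup>2\<close> and \<open>c\<^sub>4 = 16 (A\<^sup>2 + A B + B\<^sup>2)\<close>. No odd prime divides both, so the equation is minimal
  away from \<open>2\<close>, where the exponent of the minimal discriminant is twice that of \<open>A B C\<close>. The
  prime \<open>2\<close> always divides \<open>A B C\<close>; depleting it as well costs one more prime, and removing it
  from a set of primes that contains an odd prime at most halves \<open>\<Sum> log p\<close>, because
  \<open>log 2 \<le> log p\<close>. This loss is compensated by the factor \<open>2\<close> in the exponents.\<close>

section \<open>Szpiro ratios of products of prime powers\<close>

lemma prime_factors_prod_prime_powers:
  fixes I :: "int set"
  assumes "finite I" "\<And>p. p \<in> I \<Longrightarrow> prime p" "\<And>p. p \<in> I \<Longrightarrow> f p > 0"
  shows "prime_factors (\<Prod>p\<in>I. p ^ f p) = I"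
proof -
  have "0 \<notin> I"
    using assms(2) not_prime_0 by blast
  then have "(\<Prod>p\<in>I. p ^ f p) \<noteq> 0"
    using assms(1) by (simp add: prod_zero_iff)
  then have "p \<in> prime_factors (\<Prod>p\<in>I. p ^ f p) \<longleftrightarrow>
      prime p \<and> multiplicity p (\<Prod>p\<in>I. p ^ f p) > 0" for p
    by (simp add: prime_factors_multiplicity)
  moreover have "prime p \<Longrightarrow> multiplicity p (\<Prod>p\<in>I. p ^ f p) = (if p \<in> I then f p else 0)" for p
    using assms by (intro multiplicity_prod_prime_powers) auto
  ultimately show ?thesis
    using assms by (auto split: if_splits)
qed

text \<open>The empty set is excluded because its product is 1, where the ratio is 1 by convention,
  while the quotient of empty sums is 0 / 0 = 0.\<close>

lemma szpiro_ratio_prod_prime_powers: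
  fixes I :: "int set"
  assumes "finite I" "\<And>p. p \<in> I \<Longrightarrow> prime p" "\<And>p. p \<in> I \<Longrightarrow> f p > 0" "I \<noteq> {}"
  shows "szpiro_ratio (\<Prod>p\<in>I. p ^ f p) =
    (\<Sum>p\<in>I. real (f p) * ln (real_of_int p)) / (\<Sum>p\<in>I. ln (real_of_int p))"
proof -
  let ?D = "\<Prod>p\<in>I. p ^ f p"
  have pf: "prime_factors ?D = I"
    using assms by (intro prime_factors_prod_prime_powers)
  have "\<bar>?D\<bar> \<noteq> 1"
  proof
    assume "\<bar>?D\<bar> = 1"
    then have "is_unit ?D" by simp
    then have "prime_factors ?D = {}" by (simp add: prime_factorization_unit)
    with pf assms(4) show False by simp
  qed
  moreover have "multiplicity p ?D = f p" if "p \<in> I" for p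
    using multiplicity_prod_prime_powers[of I p f] assms that by auto
  ultimately show ?thesis
    by (simp add: szpiro_ratio_def pf)
qed

lemma depleted_szpiro_ratio_le:
  assumes "I \<subseteq> prime_factors D" "card I + J \<ge> card (prime_factors D)"
    "szpiro_ratio (\<Prod>p\<in>I. p ^ multiplicity p D) \<le> c"
  shows "depleted_szpiro_ratio J D \<le> c"
proof -
  let ?R = "{szpiro_ratio (\<Prod>p\<in>I. p ^ multiplicity p D) | I.
            I \<subseteq> prime_factors D \<and> card I + J \<ge> card (prime_factors D)}"
  have "finite ?R"
    by (rule finite_subset[of _ "(\<lambda>I. szpiro_ratio (\<Prod>p\<in>I. p ^ multiplicity p D)) `
      Pow (prime_factors D)"]) auto
  then have "Min ?R \<le> szpiro_ratio (\<Prod>p\<in>I. p ^ multiplicity p D)"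
    by (rule Min_le) (use assms in auto)
  with assms(3) show ?thesis
    by (simp add: depleted_szpiro_ratio_def)
qed

text \<open>The ratios form a finite set, as an image of a power set, and the full set of primes is
  admissible for every \<open>J\<close>; so the minimum belongs to a choice of
  \<open>I\<close>.\<close>

lemma depleted_szpiro_ratio_attained:
  obtains I where "I \<subseteq> prime_factors D" "card I + J \<ge> card (prime_factors D)"
    "depleted_szpiro_ratio J D = szpiro_ratio (\<Prod>p\<in>I. p ^ multiplicity p D)"
proof -
  let ?R = "{szpiro_ratio (\<Prod>p\<in>I. p ^ multiplicity p D) | I.
            I \<subseteq> prime_factors D \<and> card I + J \<ge> card (prime_factors D)}"
  have "finite ?R"
    by (rule finite_subset[of _ "(\<lambda>I. szpiro_ratio (\<Prod>p\<in>I. p ^ multiplicity p D)) `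
      Pow (prime_factors D)"]) auto
  moreover have "szpiro_ratio (\<Prod>p\<in>prime_factors D. p ^ multiplicity p D) \<in> ?R"
    by (intro CollectI exI[of _ "prime_factors D"]) simp
  then have "?R \<noteq> {}" by (metis empty_iff)
  ultimately have "depleted_szpiro_ratio J D \<in> ?R"
    unfolding depleted_szpiro_ratio_def by (rule Min_in)
  then show ?thesis
    unfolding mem_Collect_eq by (elim exE conjE) (rule that)
qed

text \<open>Separates the counting of primes from the curves: \<open>M\<close> stands for the
  minimal discriminant, about whose exponent at 2 nothing is assumed, and \<open>D\<close> for
  \<open>A * B * C\<close>. An optimal set for \<open>M\<close>, with 2 removed, serves for
  \<open>D\<close>.\<close>

lemma depleted_szpiro_ratio_transfer:
  fixes D M :: int
  assumes "D \<noteq> 0" "M \<noteq> 0" "even D"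
    and mult: "\<And>p. prime p \<Longrightarrow> p \<noteq> 2 \<Longrightarrow> multiplicity p M = 2 * multiplicity p D"
    and M: "depleted_szpiro_ratio J M \<le> c"
  shows "depleted_szpiro_ratio (Suc J) D \<le> max 1 c"
proof -
  obtain I where I: "I \<subseteq> prime_factors M" "card I + J \<ge> card (prime_factors M)"
    and "depleted_szpiro_ratio J M = szpiro_ratio (\<Prod>p\<in>I. p ^ multiplicity p M)"
    by (rule depleted_szpiro_ratio_attained)
  with M have le: "szpiro_ratio (\<Prod>p\<in>I. p ^ multiplicity p M) \<le> c" by simp
  have fin: "finite I" using I(1) finite_subset by blast
  define K where "K = I - {2}"
  have PM: "p \<in> prime_factors M \<longleftrightarrow> prime p \<and> multiplicity p M > 0"
    and PD: "p \<in> prime_factors D \<longleftrightarrow> prime p \<and> multiplicity p D > 0" for p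
    using assms(1,2) by (auto simp: prime_factors_multiplicity)
  have eq: "prime_factors M - {2} = prime_factors D - {2}"
    using PM PD mult by auto
  have 2: "2 \<in> prime_factors D"
    using assms by (auto simp: prime_factors_dvd)
  have KD: "K \<subseteq> prime_factors D" using I(1) eq by (auto simp: K_def)
  \<comment> \<open>\<open>D\<close> and \<open>M\<close> have the same odd primes, and 2 divides
    \<open>D\<close>. If \<open>K\<close> misses at most \<open>J\<close> of the odd primes, then it
    misses at most \<open>J + 1\<close> primes of \<open>D\<close>.\<close>
  have "card (prime_factors D) = Suc (card (prime_factors M - {2}))"
    unfolding eq using 2 by (metis card.remove finite_set_mset)
  moreover have "card (prime_factors M - {2}) \<le> card K + J"
  proof (cases "2 \<in> I")
    case True
    then have "card I = Suc (card K)" "2 \<in> prime_factors M"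
      using card.remove[OF fin True] I(1) by (auto simp: K_def)
    moreover from this(2) have "card (prime_factors M) = Suc (card (prime_factors M - {2}))"
      by (metis card.remove finite_set_mset)
    ultimately show ?thesis using I(2) by simp
  next
    case False
    then have "K = I" by (simp add: K_def)
    then show ?thesis using I(2) card_Diff1_le[of "prime_factors M" 2] by simp
  qed
  ultimately have cardK: "card (prime_factors D) \<le> card K + Suc J" by simp
  have "szpiro_ratio (\<Prod>p\<in>K. p ^ multiplicity p D) \<le> max 1 c"
  proof (cases "K = {}")
    \<comment> \<open>An empty product has ratio 1; this is why the bound is
      \<open>max 1 c\<close>.\<close>
    case True
    then show ?thesis by (simp add: szpiro_ratio_def)
  next
    case False
    let ?l = "\<lambda>p. ln (real_of_int p)"
    have finK: "finite K" using fin by (simp add: K_def)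
    have K: "prime p" "multiplicity p D > 0" "p \<noteq> 2" if "p \<in> K" for p
      using that KD PD by (auto simp: K_def)
    have Ip: "prime p" "multiplicity p M > 0" if "p \<in> I" for p
      using that I(1) PM by auto
    have lpos: "?l p > 0" if "prime p" for p :: int
      using prime_gt_1_int[OF that] by simp
    have sK: "(\<Sum>p\<in>K. ?l p) > 0"
      using finK False K lpos by (intro sum_pos) auto
    have KI: "K \<subseteq> I" by (auto simp: K_def)
    have sI: "(\<Sum>p\<in>I. ?l p) \<ge> (\<Sum>p\<in>K. ?l p)"
      by (rule sum_mono2[OF fin KI]) (use lpos Ip in \<open>force intro: less_imp_le\<close>)
    have "I \<noteq> {}" using False KI by auto
    then have "(\<Sum>p\<in>I. real (multiplicity p M) * ?l p) / (\<Sum>p\<in>I. ?l p) \<le> c"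
      using le szpiro_ratio_prod_prime_powers[of I "\<lambda>p. multiplicity p M"] fin Ip by auto
    then have wI: "(\<Sum>p\<in>I. real (multiplicity p M) * ?l p) \<le> c * (\<Sum>p\<in>I. ?l p)"
      using sI sK by (simp add: divide_le_eq)
    have "2 * (\<Sum>p\<in>K. real (multiplicity p D) * ?l p) = (\<Sum>p\<in>K. real (multiplicity p M) * ?l p)"
      unfolding sum_distrib_left using K mult by (intro sum.cong) auto
    also have "\<dots> \<le> (\<Sum>p\<in>I. real (multiplicity p M) * ?l p)"
      by (rule sum_mono2[OF fin KI]) (use lpos Ip in \<open>force intro: less_imp_le mult_nonneg_nonneg\<close>)
    also note wI
    finally have *: "2 * (\<Sum>p\<in>K. real (multiplicity p D) * ?l p) \<le> c * (\<Sum>p\<in>I. ?l p)" .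
    have "(\<Sum>p\<in>K. real (multiplicity p D) * ?l p) \<ge> 0"
      using K lpos by (intro sum_nonneg mult_nonneg_nonneg) (auto intro: less_imp_le)
    \<comment> \<open>A nonnegative quantity is at most \<open>c\<close> times a positive sum. The
      sign of \<open>c\<close> allows the next estimate to be multiplied by it.\<close>
    with * sI sK have c: "c \<ge> 0"
      by (smt (verit) mult_neg_pos)
    have "(\<Sum>p\<in>I. ?l p) \<le> 2 * (\<Sum>p\<in>K. ?l p)"
    proof (cases "2 \<in> I")
      case True
      \<comment> \<open>The only term of the sum over \<open>I\<close> missing from \<open>K\<close>
        is \<open>ln 2\<close>, and a single prime of \<open>K\<close> already pays for it.\<close>
      obtain q where q: "q \<in> K" using False by auto
      then have "real_of_int q \<ge> 2" using K(1) prime_ge_2_int by force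
      then have "ln 2 \<le> ?l q" by simp
      also have "\<dots> \<le> (\<Sum>p\<in>K. ?l p)"
        using q finK K lpos by (intro member_le_sum) (auto intro: less_imp_le)
      finally show ?thesis
        using sum.remove[OF fin True, of ?l] by (simp add: K_def)
    next
      case False
      then have "K = I" by (simp add: K_def)
      then show ?thesis using sK by simp
    qed
    from mult_left_mono[OF this c] *
    have "(\<Sum>p\<in>K. real (multiplicity p D) * ?l p) \<le> c * (\<Sum>p\<in>K. ?l p)" by simp
    then have "(\<Sum>p\<in>K. real (multiplicity p D) * ?l p) / (\<Sum>p\<in>K. ?l p) \<le> c"
      using sK by (simp add: divide_le_eq)
    then show ?thesis
      using szpiro_ratio_prod_prime_powers[of K "\<lambda>p. multiplicity p D"] finK K False by auto
  qed
  then show ?thesis using KD cardK by (intro depleted_szpiro_ratio_le)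
qed


section \<open>Integrality and valuations at a prime\<close>

lemma quotient_of_int_frac:
  obtains a b where "quotient_of q = (a, b)" "q = of_int a / of_int b" "b > 0" "coprime a b"
proof -
  obtain a b where "quotient_of q = (a, b)" by force
  then show ?thesis
    using that quotient_of_div quotient_of_denom_pos quotient_of_coprime by blast
qed

text \<open>Cross-multiplication with the reduced fraction shows that any fraction may be used to
  compute the valuation.\<close>

lemma rat_valuation_of_int_divide:
  assumes "prime p" "m \<noteq> 0" "n \<noteq> 0"
  shows "rat_valuation p (of_int m / of_int n) = int (multiplicity p m) - int (multiplicity p n)"
proof -
  obtain a b where ab: "quotient_of (of_int m / of_int n) = (a, b)"
    "of_int m / of_int n = (of_int a / of_int b :: rat)" "b > 0"
    by (rule quotient_of_int_frac)
  then have "(of_int (m * b) :: rat) = of_int (a * n)"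
    using assms by (simp add: field_simps)
  then have eq: "m * b = a * n" by (simp only: of_int_eq_iff)
  then have "a \<noteq> 0" using assms ab(3) by auto
  have "multiplicity p (m * b) = multiplicity p m + multiplicity p b"
    using assms ab(3) by (intro prime_elem_multiplicity_mult_distrib) auto
  moreover have "multiplicity p (a * n) = multiplicity p a + multiplicity p n"
    using assms \<open>a \<noteq> 0\<close> by (intro prime_elem_multiplicity_mult_distrib) auto
  ultimately have "multiplicity p m + multiplicity p b = multiplicity p a + multiplicity p n"
    using eq by simp
  then show ?thesis by (simp add: rat_valuation_def ab(1))
qed

text \<open>The reduced denominator divides every other denominator. Sums and products can thus be
  treated without reducing fractions.\<close>

lemma p_integral_iff:
  "p_integral p q \<longleftrightarrow> (\<exists>m n. \<not> p dvd n \<and> n \<noteq> 0 \<and> q = of_int m / of_int n)"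
proof
  assume "p_integral p q"
  then show "\<exists>m n. \<not> p dvd n \<and> n \<noteq> 0 \<and> q = of_int m / of_int n"
    by (cases rule: quotient_of_int_frac[of q]) (auto simp: p_integral_def)
next
  assume "\<exists>m n. \<not> p dvd n \<and> n \<noteq> 0 \<and> q = of_int m / of_int n"
  then obtain m n where mn: "\<not> p dvd n" "n \<noteq> 0" "q = of_int m / of_int n" by blast
  obtain a b where ab: "quotient_of q = (a, b)" "q = of_int a / of_int b" "b > 0" "coprime a b"
    by (rule quotient_of_int_frac)
  have "(of_int (m * b) :: rat) = of_int (a * n)"
    using mn ab by (simp add: field_simps)
  then have "m * b = a * n" by (simp only: of_int_eq_iff)
  then have "b dvd n"
    using ab(4) by (metis coprime_commute coprime_dvd_mult_right_iff dvd_triv_right)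
  then have "\<not> p dvd b" using mn(1) dvd_trans by blast
  then show "p_integral p q" by (simp add: p_integral_def ab(1))
qed

lemma p_integral_of_int: "prime p \<Longrightarrow> p_integral p (of_int m)"
  unfolding p_integral_iff by (rule exI[of _ m], rule exI[of _ 1]) (auto dest: not_prime_unit)

lemma p_integral_numeral: "prime p \<Longrightarrow> p_integral p (numeral k)"
  using p_integral_of_int[of p "numeral k"] by simp

lemma p_integral_mult:
  assumes "prime p" "p_integral p q" "p_integral p r"
  shows "p_integral p (q * r)"
proof -
  obtain m n m' n' where "\<not> p dvd n" "n \<noteq> 0" "q = of_int m / of_int n"
    "\<not> p dvd n'" "n' \<noteq> 0" "r = of_int m' / of_int n'"
    using assms(2,3) unfolding p_integral_iff by blast
  then have "\<not> p dvd n * n'" "n * n' \<noteq> 0" "q * r = of_int (m * m') / of_int (n * n')"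
    using assms(1) by (auto simp: prime_dvd_mult_iff)
  then show ?thesis unfolding p_integral_iff by blast
qed

lemma p_integral_add:
  assumes "prime p" "p_integral p q" "p_integral p r"
  shows "p_integral p (q + r)"
proof -
  obtain m n m' n' where "\<not> p dvd n" "n \<noteq> 0" "q = of_int m / of_int n"
    "\<not> p dvd n'" "n' \<noteq> 0" "r = of_int m' / of_int n'"
    using assms(2,3) unfolding p_integral_iff by blast
  then have "\<not> p dvd n * n'" "n * n' \<noteq> 0" "q + r = of_int (m * n' + m' * n) / of_int (n * n')"
    using assms(1) by (auto simp: prime_dvd_mult_iff field_simps)
  then show ?thesis unfolding p_integral_iff by blast
qed

lemma p_integral_diff:
  assumes "prime p" "p_integral p q" "p_integral p r"
  shows "p_integral p (q - r)"
proof -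
  have "p_integral p (of_int (- 1) * r)"
    using assms by (intro p_integral_mult p_integral_of_int)
  from p_integral_add[OF assms(1,2) this] show ?thesis by simp
qed


section \<open>Minimal equations\<close>

text \<open>The classical invariant of weight 4.\<close>

definition c4 :: "weierstrass \<Rightarrow> rat" where
  "c4 E = (b2 E)\<^sup>2 - 24 * b4 E"

text \<open>The shifts of \<open>b2\<close> and \<open>b4\<close> by \<open>r\<close> cancel in
  \<open>c4\<close>, which leaves only the scaling by \<open>u\<close>.\<close>

lemma c4_change_vars:
  assumes "u \<noteq> 0"
  shows "u ^ 4 * c4 (change_vars u r s t E) = c4 E"
proof -
  define F where "F = change_vars u r s t E"
  have a: "u * a1 F = a1 E + 2 * s" "u\<^sup>2 * a2 F = a2 E - s * a1 E + 3 * r - s\<^sup>2"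
    "u ^ 3 * a3 F = a3 E + r * a1 E + 2 * t"
    "u ^ 4 * a4 F = a4 E - s * a3 E + 2 * r * a2 E - (t + r * s) * a1 E + 3 * r\<^sup>2 - 2 * s * t"
    using assms by (simp_all add: F_def change_vars_def)
  have b2: "u\<^sup>2 * b2 F = b2 E + 12 * r"
    unfolding b2_def using a(1,2) by algebra
  have b4: "u ^ 4 * b4 F = b4 E + r * b2 E + 6 * r\<^sup>2"
    unfolding b2_def b4_def using a(1,3,4) by algebra
  show ?thesis
    unfolding c4_def F_def[symmetric] using b2 b4 by algebra
qed

lemma p_integral_c4:
  assumes "prime p" "p_integral_equation p E"
  shows "p_integral p (c4 E)"
  using assms unfolding c4_def b2_def b4_def p_integral_equation_def power2_eq_square
  by (intro p_integral_add p_integral_diff p_integral_mult p_integral_numeral) auto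

text \<open>If \<open>p\<close> does not divide \<open>c\<^sub>4\<close>, a change of variables to another \<open>p\<close>-integral equation has
  \<open>u\<close> of nonpositive valuation, as it divides \<open>c\<^sub>4\<close> by \<open>u\<^sup>4\<close>.\<close>

lemma minimal_discriminant_exponent_eq:
  assumes p: "prime p" and E: "p_integral_equation p E"
    and disc: "discriminant E = of_int N" "N \<noteq> 0"
    and c4: "c4 E = of_int k" "p dvd N \<Longrightarrow> \<not> p dvd k"
  shows "minimal_discriminant_exponent p E = multiplicity p N"
  unfolding minimal_discriminant_exponent_def
proof (rule Least_equality)
  have "change_vars 1 0 0 0 E = E" by (simp add: change_vars_def)
  moreover have "rat_valuation p (discriminant E) = int (multiplicity p N)"
    using rat_valuation_of_int_divide[of p N 1] p disc by simp
  ultimately show "\<exists>u r s t. u \<noteq> 0 \<and> p_integral_equation p (change_vars u r s t E) \<and>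
      rat_valuation p (discriminant (change_vars u r s t E)) = int (multiplicity p N)"
    using E by (intro exI[of _ 1] exI[of _ 0]) simp
next
  fix n
  assume "\<exists>u r s t. u \<noteq> 0 \<and> p_integral_equation p (change_vars u r s t E) \<and>
      rat_valuation p (discriminant (change_vars u r s t E)) = int n"
  then obtain u r s t where u: "u \<noteq> 0"
    and F: "p_integral_equation p (change_vars u r s t E)"
    and n: "rat_valuation p (discriminant (change_vars u r s t E)) = int n" by blast
  show "multiplicity p N \<le> n"
  proof (cases "p dvd N")
    case False
    then show ?thesis by (simp add: not_dvd_imp_multiplicity_0)
  next
    case True
    \<comment> \<open>With \<open>u = x / y\<close> in lowest terms, nonpositive valuation of
      \<open>u\<close> means that \<open>p\<close> does not divide \<open>x\<close>.\<close>
    obtain x y where xy: "u = of_int x / of_int y" "y > 0" "coprime x y"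
      by (rule quotient_of_int_frac)
    have x: "x \<noteq> 0" using u xy by auto
    obtain m d where md: "\<not> p dvd d" "d \<noteq> 0" "c4 (change_vars u r s t E) = of_int m / of_int d"
      using p_integral_c4[OF p F] unfolding p_integral_iff by blast
    have "u ^ 4 * (of_int m / of_int d) = of_int k"
      using c4_change_vars[OF u, of r s t E] md(3) c4(1) by simp
    then have "(of_int (x ^ 4 * m) :: rat) = of_int (k * y ^ 4 * d)"
      using xy md(2) by (simp add: field_simps)
    then have eq: "x ^ 4 * m = k * y ^ 4 * d" by (simp only: of_int_eq_iff)
    have px: "\<not> p dvd x"
    proof
      assume "p dvd x"
      then have "\<not> p dvd y" using xy(3) p by (meson coprime_common_divisor not_prime_unit)
      \<comment> \<open>The left side of \<open>eq\<close> is divisible by \<open>p\<close>, but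
        none of \<open>k\<close>, \<open>y\<close>, \<open>d\<close> is.\<close>
      moreover have "p dvd k * y ^ 4 * d"
        unfolding eq[symmetric] using \<open>p dvd x\<close> by (intro dvd_mult2 dvd_trans[OF _ dvd_power]) auto
      ultimately show False
        using c4(2)[OF True] md(1) p by (auto simp: prime_dvd_mult_iff dest: prime_dvd_power)
    qed
    have "u ^ 12 * discriminant (change_vars u r s t E) = of_int N"
      using discriminant_change_vars[OF u] disc(1) by simp
    moreover have "u ^ 12 * of_int y ^ 12 = of_int x ^ 12"
      using xy by (simp add: power_divide)
    ultimately have "discriminant (change_vars u r s t E) * of_int x ^ 12 = of_int N * of_int y ^ 12"
      by (metis mult.assoc mult.commute)
    then have "discriminant (change_vars u r s t E) = of_int (N * y ^ 12) / of_int (x ^ 12)"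
      using x by (simp add: eq_divide_eq)
    \<comment> \<open>The new valuation exceeds that of \<open>N\<close> by 12 times the valuation
      of \<open>y\<close>, as \<open>x\<close> contributes nothing.\<close>
    then have "int n = int (multiplicity p (N * y ^ 12)) - int (multiplicity p (x ^ 12))"
      using n rat_valuation_of_int_divide[of p "N * y ^ 12" "x ^ 12"] p disc(2) x xy(2) by simp
    moreover have "multiplicity p (x ^ 12) = 0"
      using px p by (intro not_dvd_imp_multiplicity_0) (auto dest: prime_dvd_power)
    moreover have "multiplicity p (N * y ^ 12) = multiplicity p N + multiplicity p (y ^ 12)"
      using p disc(2) xy(2) by (intro prime_elem_multiplicity_mult_distrib) auto
    ultimately show ?thesis by simp
  qed
qed


section \<open>The Frey curve\<close>

definition frey_curve :: "int \<Rightarrow> int \<Rightarrow> weierstrass" where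
  "frey_curve A B = \<lparr> a1 = 0, a2 = of_int (B - A), a3 = 0, a4 = of_int (- A * B), a6 = 0 \<rparr>"

text \<open>The roots 0, \<open>A\<close>, \<open>- B\<close> of the cubic differ by
  \<open>A\<close>, \<open>B\<close> and \<open>A + B = - C\<close> up to sign; the discriminant is
  16 times the product of the squared differences.\<close>

lemma discriminant_frey_curve:
  "A + B + C = 0 \<Longrightarrow> discriminant (frey_curve A B) = of_int (2 ^ 4 * (A * B * C)\<^sup>2)"
proof -
  assume "A + B + C = 0"
  then have "C = - A - B" by simp
  then show ?thesis
    by (simp add: frey_curve_def discriminant_def b2_def b4_def b6_def b8_def)
      (simp add: power2_eq_square power3_eq_cube algebra_simps)
qed

lemma c4_frey_curve: "c4 (frey_curve A B) = of_int (2 ^ 4 * (A\<^sup>2 + A * B + B\<^sup>2))"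
  by (simp add: frey_curve_def c4_def b2_def b4_def) algebra

text \<open>An odd prime dividing both the discriminant and \<open>c4\<close> would divide two of
  \<open>A\<close>, \<open>B\<close>, \<open>C\<close>, hence all three, against the gcd condition.
  So the given equation is minimal at \<open>p\<close>.\<close>

lemma minimal_discriminant_exponent_frey_curve:
  assumes ABC: "A + B + C = 0" "A * B * C \<noteq> 0" "Gcd {A, B, C} = 1"
    and p: "prime p" "p \<noteq> 2"
  shows "minimal_discriminant_exponent p (frey_curve A B) = 2 * multiplicity p (A * B * C)"
proof -
  have np2: "\<not> p dvd 2 ^ 4"
    using p primes_dvd_imp_eq[of p 2] prime_dvd_power[of p 2 4] by fastforce
  have C: "C = - A - B" using ABC(1) by simp
  have cop: "\<not> (p dvd A \<and> p dvd B)"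
  proof
    assume "p dvd A \<and> p dvd B"
    then have "p dvd Gcd {A, B, C}" using C by (intro Gcd_greatest) auto
    then have "is_unit p" by (simp only: ABC(3))
    then show False using p(1) not_prime_unit by blast
  qed
  have "\<not> p dvd 2 ^ 4 * (A\<^sup>2 + A * B + B\<^sup>2)" if "p dvd 2 ^ 4 * (A * B * C)\<^sup>2"
  proof
    assume "p dvd 2 ^ 4 * (A\<^sup>2 + A * B + B\<^sup>2)"
    then have q: "p dvd A\<^sup>2 + A * B + B\<^sup>2"
      using np2 p(1) prime_dvd_multD by blast
    have "p dvd A * B * C"
      using that np2 p(1) prime_dvd_power by (metis prime_dvd_mult_iff)
    then consider "p dvd A" | "p dvd B" | "p dvd C"
      using p(1) by (auto simp: prime_dvd_mult_iff)
    then show False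
    proof cases
      case 1
      \<comment> \<open>Modulo \<open>A\<close> the form reduces to the square of \<open>B\<close>;
        the other two cases reduce it modulo \<open>B\<close> and modulo \<open>C\<close> in the
        same way.\<close>
      moreover have "B\<^sup>2 = (A\<^sup>2 + A * B + B\<^sup>2) - A * (A + B)" by algebra
      ultimately have "p dvd B\<^sup>2" using q by (metis dvd_diff dvd_mult2)
      with 1 show False using cop p(1) prime_dvd_power by blast
    next
      case 2
      moreover have "A\<^sup>2 = (A\<^sup>2 + A * B + B\<^sup>2) - B * (A + B)" by algebra
      ultimately have "p dvd A\<^sup>2" using q by (metis dvd_diff dvd_mult2)
      with 2 show False using cop p(1) prime_dvd_power by blast
    next
      case 3
      moreover have "A\<^sup>2 = (A\<^sup>2 + A * B + B\<^sup>2) - C * (- B)" unfolding C by algebra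
      ultimately have "p dvd A\<^sup>2" using q by (metis dvd_diff dvd_mult2)
      then have "p dvd A" using p(1) prime_dvd_power by blast
      moreover have "B = - C - A" using C by simp
      ultimately show False using 3 cop by (metis dvd_diff dvd_minus_iff)
    qed
  qed
  moreover have "p_integral_equation p (frey_curve A B)"
    using p_integral_of_int[OF p(1)] p_integral_of_int[OF p(1), of 0]
    by (simp add: p_integral_equation_def frey_curve_def del: of_int_diff of_int_mult of_int_minus)
  ultimately have "minimal_discriminant_exponent p (frey_curve A B) =
      multiplicity p (2 ^ 4 * (A * B * C)\<^sup>2)"
    using ABC(2) p(1)
    by (intro minimal_discriminant_exponent_eq[OF _ _ discriminant_frey_curve[OF ABC(1)] _ c4_frey_curve])
      auto
  also have "\<dots> = multiplicity p (2 ^ 4 :: int) + multiplicity p ((A * B * C)\<^sup>2)"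
    using ABC(2) p(1) by (intro prime_elem_multiplicity_mult_distrib) auto
  also have "multiplicity p (2 ^ 4 :: int) = 0"
    using np2 by (rule not_dvd_imp_multiplicity_0)
  also have "multiplicity p ((A * B * C)\<^sup>2) = 2 * multiplicity p (A * B * C)"
    using ABC(2) p(1) by (intro prime_elem_multiplicity_power_distrib) auto
  finally show ?thesis by simp
qed

lemma multiplicity_minimal_discriminant_frey_curve:
  assumes ABC: "A + B + C = 0" "A * B * C \<noteq> 0" "Gcd {A, B, C} = 1"
  shows "minimal_discriminant (frey_curve A B) \<noteq> 0"
    and "prime p \<Longrightarrow> p \<noteq> 2 \<Longrightarrow>
      multiplicity p (minimal_discriminant (frey_curve A B)) = 2 * multiplicity p (A * B * C)"
proof -
  let ?e = "\<lambda>p. minimal_discriminant_exponent p (frey_curve A B)"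
  let ?S = "{p. prime p \<and> ?e p \<noteq> 0}"
  have "?S \<subseteq> insert 2 (prime_factors (A * B * C))"
    using minimal_discriminant_exponent_frey_curve[OF ABC] ABC(2)
    by (auto simp: prime_factors_multiplicity)
  then have fin: "finite ?S"
    by (rule finite_subset) simp
  show "minimal_discriminant (frey_curve A B) \<noteq> 0"
    using fin by (auto simp: minimal_discriminant_def prod_zero_iff)
  assume p: "prime p" "p \<noteq> 2"
  have "multiplicity p (minimal_discriminant (frey_curve A B)) = (if p \<in> ?S then ?e p else 0)"
    unfolding minimal_discriminant_def using fin p(1)
    by (intro multiplicity_prod_prime_powers) auto
  also have "\<dots> = ?e p" using p(1) by auto
  also have "\<dots> = 2 * multiplicity p (A * B * C)"
    by (rule minimal_discriminant_exponent_frey_curve[OF ABC p])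
  finally show "multiplicity p (minimal_discriminant (frey_curve A B)) =
    2 * multiplicity p (A * B * C)" .
qed

theorem proposition11:
  assumes "\<exists>(J :: nat) (C3 :: real). \<forall>E. elliptic_curve E \<longrightarrow>
             depleted_szpiro_ratio J (minimal_discriminant E) \<le> C3"
  shows "\<exists>(J' :: nat) (C5 :: real). \<forall>A B C :: int.
             A \<noteq> 0 \<and> B \<noteq> 0 \<and> C \<noteq> 0 \<and> A + B + C = 0 \<and> Gcd {A, B, C} = 1 \<longrightarrow>
             depleted_szpiro_ratio J' (A * B * C) \<le> C5"
proof -
  obtain J C3 where szpiro: "\<And>E. elliptic_curve E \<Longrightarrow>
      depleted_szpiro_ratio J (minimal_discriminant E) \<le> C3"
    using assms by blast
  \<comment> \<open>The extra depleted prime is 2.\<close>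
  have "depleted_szpiro_ratio (Suc J) (A * B * C) \<le> max 1 C3"
    if "A \<noteq> 0" "B \<noteq> 0" "C \<noteq> 0" and sum: "A + B + C = 0" and gcd: "Gcd {A, B, C} = 1" for A B C
  proof (rule depleted_szpiro_ratio_transfer)
    show nz: "A * B * C \<noteq> 0" using that by simp
    show "minimal_discriminant (frey_curve A B) \<noteq> 0"
      using multiplicity_minimal_discriminant_frey_curve(1) sum nz gcd .
    show "multiplicity p (minimal_discriminant (frey_curve A B)) = 2 * multiplicity p (A * B * C)"
      if "prime p" "p \<noteq> 2" for p
      using multiplicity_minimal_discriminant_frey_curve(2) sum nz gcd that .
    \<comment> \<open>One of \<open>A\<close>, \<open>B\<close> and \<open>A + B\<close> is always
      even.\<close>
    have "C = - A - B" using sum by simp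
    then show "even (A * B * C)" by auto
    have "discriminant (frey_curve A B) \<noteq> 0"
      unfolding discriminant_frey_curve[OF sum] of_int_eq_0_iff using nz by simp
    then show "depleted_szpiro_ratio J (minimal_discriminant (frey_curve A B)) \<le> C3"
      by (intro szpiro) (simp add: elliptic_curve_def)
  qed
  then show ?thesis by blast
qed

end
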